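(* Let $p:\mathcal{Q}\to\mathcal{C}$ be a functor of categories. If $p$ is ULF, then so is the functor of operads $\mathcal{W}[p]:\mathcal{W}[\mathcal{Q}]\to\mathcal{W}[\mathcal{C}]$. Moreover, if $p$ is finitary then so is $\mathcal{W}[p]$.
   Context: "Operad" means colored non-symmetric operad (multicategory). Composition of arrows in categories is written in diagrammatic order. The operad $\mathcal{W}[\mathcal{C}]$ of spliced arrows of a category $\mathcal{C}$ has as colors the pairs $(A,B)$ of objects; an $n$-ary operation $(A_1,B_1),\dots,(A_n,B_n)\to(A,B)$ is a sequence $w_0{-}\cdots{-}w_n$ of arrows $w_i:B_i\to A_{i+1}$ ($0\le i\le n$, with $B_0=A$, $A_{n+1}=B$). Composition substitutes spliced arrows for the gaps "$-$", interpreting juxtaposition as composition in $\mathcal{C}$; the identity on $(A,B)$ is $\mathrm{id}_A{-}\mathrm{id}_B$. $\mathcal{W}[p]$ acts by $(A,B)\mapsto(pA,pB)$ and $w_0{-}\cdots{-}w_n\mapsto p(w_0){-}\cdots{-}p(w_n)$. A functor of categories $p:\mathcal{Q}\to\mathcal{C}$ is ULF (unique lifting of factorizations) if for every arrow $\alpha$ of $\mathcal{Q}$ with $p(\alpha)=uv$ there is a unique pair $(\beta,\gamma)$ of arrows of $\mathcal{Q}$ with $\alpha=\beta\gamma$, $p(\beta)=u$, $p(\gamma)=v$. It is finitary if the fibers $p^{-1}(A)$ and $p^{-1}(w)$ are finite for every object $A$ and arrow $w$ of $\mathcal{C}$. A functor of operads $p:\mathcal{D}\to\mathcal{T}$ is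 ULF if for every operation $\alpha$ of $\mathcal{D}$ with $p(\alpha)=g\circ(h_1,\dots,h_n)$ there exist a unique operation $\beta$ and a unique list of operations $\gamma_1,\dots,\gamma_n$ of $\mathcal{D}$ such that $\alpha=\beta\circ(\gamma_1,\dots,\gamma_n)$, $p(\beta)=g$ and $p(\gamma_i)=h_i$ for all $i$. It is finitary if $p^{-1}(A)$ and $p^{-1}(f)$ are finite for every color $A$ and operation $f$ of $\mathcal{T}$. *)

theory Defs
  imports Main
begin

section \<open>Categories and functors\<close>

text \<open>Composition is in diagrammatic order: \<open>f \<cdot> g\<close> is \<open>f\<close> followed by \<open>g\<close>.
  The record fields are total functions; only their values on the carriers matter.\<close>

record ('o, 'a) category_data =
  Obj :: "'o set"
  Arr :: "'a set"
  Dom :: "'a \<Rightarrow> 'o"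
  Cod :: "'a \<Rightarrow> 'o"
  Id :: "'o \<Rightarrow> 'a"
  Comp :: "'a \<Rightarrow> 'a \<Rightarrow> 'a" (infixl "\<cdot>\<index>" 70)

locale category =
  fixes C :: "('o, 'a) category_data" (structure)
  assumes Dom_in: "f \<in> Arr C \<Longrightarrow> Dom C f \<in> Obj C"
    and Cod_in: "f \<in> Arr C \<Longrightarrow> Cod C f \<in> Obj C"
    and Id_in: "A \<in> Obj C \<Longrightarrow> Id C A \<in> Arr C"
    and Dom_Id: "A \<in> Obj C \<Longrightarrow> Dom C (Id C A) = A"
    and Cod_Id: "A \<in> Obj C \<Longrightarrow> Cod C (Id C A) = A"
    and Comp_in: "\<lbrakk>f \<in> Arr C; g \<in> Arr C; Cod C f = Dom C g\<rbrakk> \<Longrightarrow> f \<cdot> g \<in> Arr C"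
    and Dom_Comp: "\<lbrakk>f \<in> Arr C; g \<in> Arr C; Cod C f = Dom C g\<rbrakk> \<Longrightarrow> Dom C (f \<cdot> g) = Dom C f"
    and Cod_Comp: "\<lbrakk>f \<in> Arr C; g \<in> Arr C; Cod C f = Dom C g\<rbrakk> \<Longrightarrow> Cod C (f \<cdot> g) = Cod C g"
    and Id_Comp: "f \<in> Arr C \<Longrightarrow> Id C (Dom C f) \<cdot> f = f"
    and Comp_Id: "f \<in> Arr C \<Longrightarrow> f \<cdot> Id C (Cod C f) = f"
    and Comp_assoc: "\<lbrakk>f \<in> Arr C; g \<in> Arr C; h \<in> Arr C; Cod C f = Dom C g; Cod C g = Dom C h\<rbrakk>
      \<Longrightarrow> f \<cdot> g \<cdot> h = f \<cdot> (g \<cdot> h)"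

record ('o, 'a, 'p, 'b) functor_data =
  on_Obj :: "'o \<Rightarrow> 'p"
  on_Arr :: "'a \<Rightarrow> 'b"

locale category_functor = Q: category Q + C: category C
  for Q :: "('o, 'a) category_data" and C :: "('p, 'b) category_data"
    and p :: "('o, 'a, 'p, 'b) functor_data" +
  assumes on_Obj_in: "A \<in> Obj Q \<Longrightarrow> on_Obj p A \<in> Obj C"
    and on_Arr_in: "f \<in> Arr Q \<Longrightarrow> on_Arr p f \<in> Arr C"
    and Dom_on_Arr: "f \<in> Arr Q \<Longrightarrow> Dom C (on_Arr p f) = on_Obj p (Dom Q f)"
    and Cod_on_Arr: "f \<in> Arr Q \<Longrightarrow> Cod C (on_Arr p f) = on_Obj p (Cod Q f)"
    and on_Arr_Id: "A \<in> Obj Q \<Longrightarrow> on_Arr p (Id Q A) = Id C (on_Obj p A)"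
    and on_Arr_Comp: "\<lbrakk>f \<in> Arr Q; g \<in> Arr Q; Cod Q f = Dom Q g\<rbrakk>
      \<Longrightarrow> on_Arr p (f \<cdot>\<^bsub>Q\<^esub> g) = on_Arr p f \<cdot>\<^bsub>C\<^esub> on_Arr p g"

locale ulf_category_functor = category_functor +
  assumes unique_lift:
    "\<lbrakk>\<alpha> \<in> Arr Q; u \<in> Arr C; v \<in> Arr C; Cod C u = Dom C v; on_Arr p \<alpha> = u \<cdot>\<^bsub>C\<^esub> v\<rbrakk>
      \<Longrightarrow> \<exists>!(\<beta>, \<gamma>). \<beta> \<in> Arr Q \<and> \<gamma> \<in> Arr Q \<and> Cod Q \<beta> = Dom Q \<gamma> \<and>
            \<alpha> = \<beta> \<cdot>\<^bsub>Q\<^esub> \<gamma> \<and> on_Arr p \<beta> = u \<and> on_Arr p \<gamma> = v"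

locale finitary_category_functor = category_functor +
  assumes finite_Obj_fiber: "A \<in> Obj C \<Longrightarrow> finite {X \<in> Obj Q. on_Obj p X = A}"
    and finite_Arr_fiber: "w \<in> Arr C \<Longrightarrow> finite {f \<in> Arr Q. on_Arr p f = w}"


section \<open>Colored non-symmetric operads and their functors\<close>

text \<open>\<open>OpComp D g [h\<^sub>1, \<dots>, h\<^sub>n]\<close> is the parallel composite \<open>g \<circ> (h\<^sub>1, \<dots>, h\<^sub>n)\<close>.\<close>

record ('c, 'f) operad_data =
  Colors :: "'c set"
  Ops :: "'f set"
  Inputs :: "'f \<Rightarrow> 'c list"
  Output :: "'f \<Rightarrow> 'c"
  OpId :: "'c \<Rightarrow> 'f"
  OpComp :: "'f \<Rightarrow> 'f list \<Rightarrow> 'f"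

definition composable :: "('c, 'f) operad_data \<Rightarrow> 'f \<Rightarrow> 'f list \<Rightarrow> bool" where
  "composable D g hs \<longleftrightarrow> g \<in> Ops D \<and> set hs \<subseteq> Ops D \<and> map (Output D) hs = Inputs D g"

locale operad =
  fixes D :: "('c, 'f) operad_data"
  assumes Inputs_in: "f \<in> Ops D \<Longrightarrow> set (Inputs D f) \<subseteq> Colors D"
    and Output_in: "f \<in> Ops D \<Longrightarrow> Output D f \<in> Colors D"
    and OpId_in: "c \<in> Colors D \<Longrightarrow> OpId D c \<in> Ops D"
    and Inputs_OpId: "c \<in> Colors D \<Longrightarrow> Inputs D (OpId D c) = [c]"
    and Output_OpId: "c \<in> Colors D \<Longrightarrow> Output D (OpId D c) = c"
    and OpComp_in: "composable D g hs \<Longrightarrow> OpComp D g hs \<in> Ops D"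
    and Inputs_OpComp:
      "composable D g hs \<Longrightarrow> Inputs D (OpComp D g hs) = concat (map (Inputs D) hs)"
    and Output_OpComp: "composable D g hs \<Longrightarrow> Output D (OpComp D g hs) = Output D g"
    and OpId_OpComp: "f \<in> Ops D \<Longrightarrow> OpComp D (OpId D (Output D f)) [f] = f"
    and OpComp_OpId: "f \<in> Ops D \<Longrightarrow> OpComp D f (map (OpId D) (Inputs D f)) = f"
    and OpComp_assoc: "\<lbrakk>composable D g hs; list_all2 (composable D) hs kss\<rbrakk>
      \<Longrightarrow> OpComp D (OpComp D g hs) (concat kss) = OpComp D g (map2 (OpComp D) hs kss)"

record ('c, 'f, 'd, 'g) operad_functor_data =
  on_Color :: "'c \<Rightarrow> 'd"
  on_Op :: "'f \<Rightarrow> 'g"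

locale operad_functor = D: operad D + T: operad T
  for D :: "('c, 'f) operad_data" and T :: "('d, 'g) operad_data"
    and F :: "('c, 'f, 'd, 'g) operad_functor_data" +
  assumes on_Color_in: "c \<in> Colors D \<Longrightarrow> on_Color F c \<in> Colors T"
    and on_Op_in: "f \<in> Ops D \<Longrightarrow> on_Op F f \<in> Ops T"
    and Inputs_on_Op: "f \<in> Ops D \<Longrightarrow> Inputs T (on_Op F f) = map (on_Color F) (Inputs D f)"
    and Output_on_Op: "f \<in> Ops D \<Longrightarrow> Output T (on_Op F f) = on_Color F (Output D f)"
    and on_Op_OpId: "c \<in> Colors D \<Longrightarrow> on_Op F (OpId D c) = OpId T (on_Color F c)"
    and on_Op_OpComp: "composable D g hs
      \<Longrightarrow> on_Op F (OpComp D g hs) = OpComp T (on_Op F g) (map (on_Op F) hs)"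

locale ulf_operad_functor = operad_functor +
  assumes unique_lift:
    "\<lbrakk>\<alpha> \<in> Ops D; composable T g hs; on_Op F \<alpha> = OpComp T g hs\<rbrakk>
      \<Longrightarrow> \<exists>!(\<beta>, \<gamma>s). composable D \<beta> \<gamma>s \<and> \<alpha> = OpComp D \<beta> \<gamma>s \<and>
            on_Op F \<beta> = g \<and> map (on_Op F) \<gamma>s = hs"

locale finitary_operad_functor = operad_functor +
  assumes finite_Color_fiber: "A \<in> Colors T \<Longrightarrow> finite {X \<in> Colors D. on_Color F X = A}"
    and finite_Op_fiber: "f \<in> Ops T \<Longrightarrow> finite {\<alpha> \<in> Ops D. on_Op F \<alpha> = f}"


section \<open>The operad of spliced arrows\<close>

text \<open>An \<open>n\<close>-ary operation \<open>w\<^sub>0-\<dots>-w\<^sub>n\<close> is the list \<open>[w\<^sub>0, \<dots>, w\<^sub>n]\<close> of its arrows.  Since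
  \<open>w\<^sub>i : B\<^sub>i \<rightarrow> A\<^sub>i\<^sub>+\<^sub>1\<close> with \<open>B\<^sub>0 = A\<close> and \<open>A\<^sub>n\<^sub>+\<^sub>1 = B\<close>, its colors are determined by the arrows:
  the \<open>i\<close>-th input is \<open>(A\<^sub>i, B\<^sub>i) = (cod w\<^sub>i\<^sub>-\<^sub>1, dom w\<^sub>i)\<close> and the output is
  \<open>(A, B) = (dom w\<^sub>0, cod w\<^sub>n)\<close>; conversely every nonempty list of arrows is an operation.\<close>

definition gaps :: "('o, 'a) category_data \<Rightarrow> 'a list \<Rightarrow> ('o \<times> 'o) list" where
  "gaps C ws = zip (map (Cod C) (butlast ws)) (map (Dom C) (tl ws))"

text \<open>Juxtaposition of spliced arrows: the two arrows that meet at the seam are composed in \<open>C\<close>.\<close>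

definition juxtapose :: "('o, 'a) category_data \<Rightarrow> 'a list \<Rightarrow> 'a list \<Rightarrow> 'a list" where
  "juxtapose C us vs = butlast us @ [last us \<cdot>\<^bsub>C\<^esub> hd vs] @ tl vs"

text \<open>\<open>plug C [w\<^sub>0, \<dots>, w\<^sub>n] [h\<^sub>1, \<dots>, h\<^sub>n]\<close> is the juxtaposition \<open>w\<^sub>0 h\<^sub>1 w\<^sub>1 \<dots> h\<^sub>n w\<^sub>n\<close>.  The last two
  equations are only relevant to arguments whose lengths match: there the second applies just to
  \<open>plug C [w] [] = [w]\<close>, and the third not at all.\<close>

fun plug :: "('o, 'a) category_data \<Rightarrow> 'a list \<Rightarrow> 'a list list \<Rightarrow> 'a list" where
  "plug C (w # ws) (h # hs) = juxtapose C [w] (juxtapose C h (plug C ws hs))"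
| "plug C ws [] = ws"
| "plug C [] hs = []"

definition spliced_arrows :: "('o, 'a) category_data \<Rightarrow> ('o \<times> 'o, 'a list) operad_data"
  ("\<W>[_]") where
  "\<W>[C] = \<lparr>
     Colors = Obj C \<times> Obj C,
     Ops = {ws. ws \<noteq> [] \<and> set ws \<subseteq> Arr C},
     Inputs = gaps C,
     Output = (\<lambda>ws. (Dom C (hd ws), Cod C (last ws))),
     OpId = (\<lambda>(A, B). [Id C A, Id C B]),
     OpComp = plug C\<rparr>"

definition spliced_functor :: "('o, 'a, 'p, 'b) functor_data
    \<Rightarrow> ('o \<times> 'o, 'a list, 'p \<times> 'p, 'b list) operad_functor_data" ("\<W>\<^sub>F[_]") where
  "\<W>\<^sub>F[p] = \<lparr>on_Color = map_prod (on_Obj p) (on_Obj p), on_Op = map (on_Arr p)\<rparr>"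


text \<open>\<open>\<W>[C]\<close> is an operad and \<open>\<W>[p]\<close> is a functor of operads.\<close>

context category
begin

definition spliced :: "'a list \<Rightarrow> bool" where
  "spliced ws \<longleftrightarrow> ws \<noteq> [] \<and> set ws \<subseteq> Arr C"

definition seam :: "'a list \<Rightarrow> 'a list \<Rightarrow> bool" where
  "seam us vs \<longleftrightarrow> spliced us \<and> spliced vs \<and> Cod C (last us) = Dom C (hd vs)"

lemma gaps_simps [simp]:
  "gaps C [] = []" "gaps C [w] = []"
  "gaps C (w # w' # ws) = (Cod C w, Dom C w') # gaps C (w' # ws)"
  by (simp_all add: gaps_def)

lemma length_gaps [simp]: "length (gaps C ws) = length ws - 1"
  by (simp add: gaps_def)

lemma juxtapose_Cons: "us \<noteq> [] \<Longrightarrow> juxtapose C (u # us) vs = u # juxtapose C us vs"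
  by (simp add: juxtapose_def)

lemma juxtapose_single: "juxtapose C [u] (v # vs) = u \<cdot> v # vs"
  by (simp add: juxtapose_def)

lemma juxtapose_not_Nil [simp]: "juxtapose C us vs \<noteq> []"
  by (simp add: juxtapose_def)

lemma spliced_Cons: "spliced (u # us) \<longleftrightarrow> u \<in> Arr C \<and> (us = [] \<or> spliced us)"
  by (auto simp: spliced_def)

lemma juxtapose_typing:
  assumes "seam us vs"
  shows "spliced (juxtapose C us vs) \<and> Dom C (hd (juxtapose C us vs)) = Dom C (hd us) \<and>
    Cod C (last (juxtapose C us vs)) = Cod C (last vs) \<and>
    gaps C (juxtapose C us vs) = gaps C us @ gaps C vs"
  using assms
proof (induction us)
  case Nil
  then show ?case by (simp add: seam_def spliced_def)
next
  case (Cons u us)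
  obtain v vs' where vs: "vs = v # vs'" using Cons.prems by (cases vs) (auto simp: seam_def spliced_def)
  show ?case
  proof (cases us)
    case Nil
    have uv: "u \<in> Arr C" "v \<in> Arr C" "Cod C u = Dom C v"
      using Cons.prems Nil vs by (auto simp: seam_def spliced_def)
    have "gaps C (u \<cdot> v # vs') = gaps C (v # vs')"
      using uv by (cases vs') (simp_all add: Cod_Comp)
    then show ?thesis
      using Cons.prems Nil vs uv
      by (auto simp: seam_def spliced_def juxtapose_single Comp_in Dom_Comp Cod_Comp)
  next
    case (Cons u' us')
    have s: "seam us vs" using Cons.prems Cons by (auto simp: seam_def spliced_def)
    obtain x xs where x: "juxtapose C us vs = x # xs" by (cases "juxtapose C us vs") auto
    have "u \<in> Arr C" using Cons.prems by (auto simp: seam_def spliced_def)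
    with Cons.IH[OF s] x Cons show ?thesis
      by (auto simp: juxtapose_Cons spliced_def)
  qed
qed

lemma seam_juxtapose1: "seam us vs \<Longrightarrow> seam vs ws \<Longrightarrow> seam (juxtapose C us vs) ws"
  using juxtapose_typing by (auto simp: seam_def)

lemma seam_juxtapose2: "seam us vs \<Longrightarrow> seam vs ws \<Longrightarrow> seam us (juxtapose C vs ws)"
  using juxtapose_typing by (auto simp: seam_def)

lemma juxtapose_assoc:
  assumes "seam us vs" "seam vs ws"
  shows "juxtapose C (juxtapose C us vs) ws = juxtapose C us (juxtapose C vs ws)"
proof (cases "tl vs = []")
  case True
  then obtain v where v: "vs = [v]" using assms by (cases vs) (auto simp: seam_def spliced_def)
  have "last us \<cdot> v \<cdot> hd ws = last us \<cdot> (v \<cdot> hd ws)"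
    using assms v by (intro Comp_assoc) (auto simp: seam_def spliced_def)
  then show ?thesis by (simp add: juxtapose_def v)
next
  case False
  then obtain v vs' where v: "vs = v # vs'" "vs' \<noteq> []" by (cases vs) auto
  then show ?thesis by (simp add: juxtapose_def butlast_append)
qed

lemma plug_typing:
  assumes "spliced ws" "\<forall>h\<in>set hs. spliced h"
    "map (\<lambda>h. (Dom C (hd h), Cod C (last h))) hs = gaps C ws"
  shows "spliced (plug C ws hs) \<and> Dom C (hd (plug C ws hs)) = Dom C (hd ws) \<and>
    Cod C (last (plug C ws hs)) = Cod C (last ws) \<and>
    gaps C (plug C ws hs) = concat (map (gaps C) hs)"
  using assms
proof (induction hs arbitrary: ws)
  case Nil
  then have "length ws - 1 = 0" by (metis length_gaps list.map(1) list.size(3))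
  with Nil obtain w where "ws = [w]" by (cases ws) (auto simp: spliced_def)
  with Nil show ?case by simp
next
  case (Cons h hs)
  from Cons.prems(3) obtain w w' ws' where ws: "ws = w # w' # ws'"
    by (cases ws; cases "tl ws") auto
  let ?R = "plug C (w' # ws') hs"
  have R: "spliced ?R" "Dom C (hd ?R) = Dom C w'" "Cod C (last ?R) = Cod C (last ws)"
    "gaps C ?R = concat (map (gaps C) hs)"
    using Cons.IH[of "w' # ws'"] Cons.prems ws by (auto simp: spliced_def)
  have s1: "seam h ?R" and s2: "seam [w] h"
    using Cons.prems ws R by (auto simp: seam_def spliced_def)
  show ?case
    using juxtapose_typing[OF s1] juxtapose_typing[OF seam_juxtapose2[OF s2 s1]] s2 ws R
    by (auto simp: seam_def)
qed

abbreviation fits :: "'a list \<Rightarrow> 'a list list \<Rightarrow> bool" where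
  "fits ws hs \<equiv> composable \<W>[C] ws hs"

lemma fits_def: "fits ws hs \<longleftrightarrow> spliced ws \<and> (\<forall>h\<in>set hs. spliced h) \<and>
    map (\<lambda>h. (Dom C (hd h), Cod C (last h))) hs = gaps C ws"
  by (auto simp: composable_def spliced_arrows_def spliced_def)

lemma fits_plug:
  assumes "fits ws hs"
  shows "spliced (plug C ws hs)" "Dom C (hd (plug C ws hs)) = Dom C (hd ws)"
    "Cod C (last (plug C ws hs)) = Cod C (last ws)"
    "gaps C (plug C ws hs) = concat (map (gaps C) hs)"
  using plug_typing assms unfolding fits_def by blast+

lemma fits_Cons:
  assumes "fits ws (h # hs)"
  obtains w w' ws' where "ws = w # w' # ws'" "fits (w' # ws') hs" "seam [w] h"
    "seam h (plug C (w' # ws') hs)"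
proof -
  from assms obtain w w' ws' where ws: "ws = w # w' # ws'"
    unfolding fits_def by (cases ws; cases "tl ws") auto
  moreover have f: "fits (w' # ws') hs" using assms ws by (auto simp: fits_def spliced_def)
  moreover have "seam [w] h" "seam h (plug C (w' # ws') hs)"
    using assms ws fits_plug[OF f] by (auto simp: fits_def seam_def spliced_def)
  ultimately show ?thesis using that by blast
qed

lemma fits_Nil: "fits ws [] \<longleftrightarrow> (\<exists>w. ws = [w] \<and> w \<in> Arr C)"
proof
  assume a: "fits ws []"
  then have "length ws - 1 = 0" unfolding fits_def by (metis length_gaps list.map(1) list.size(3))
  with a show "\<exists>w. ws = [w] \<and> w \<in> Arr C" by (cases ws) (auto simp: fits_def spliced_def)
qed (auto simp: fits_def spliced_def)

lemma plug_juxtapose: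
  assumes "seam us vs" "fits us ks" "fits vs ls"
  shows "plug C (juxtapose C us vs) (ks @ ls) = juxtapose C (plug C us ks) (plug C vs ls)"
  using assms
proof (induction ks arbitrary: us)
  case Nil
  then obtain u where u: "us = [u]" "u \<in> Arr C" by (auto simp: fits_Nil)
  show ?case
  proof (cases ls)
    case Nil2: Nil
    then obtain v where "vs = [v]" using Nil by (auto simp: fits_Nil)
    with u Nil2 show ?thesis by (simp add: juxtapose_single)
  next
    case (Cons l ls')
    with Nil.prems(3) obtain v v' vs' where v: "vs = v # v' # vs'" "fits (v' # vs') ls'"
      "seam [v] l" "seam l (plug C (v' # vs') ls')" by (auto elim: fits_Cons)
    have uv: "seam [u] [v]" using Nil.prems u v by (auto simp: seam_def spliced_def)
    have "juxtapose C [u \<cdot> v] (juxtapose C l (plug C (v' # vs') ls')) =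
      juxtapose C [u] (juxtapose C [v] (juxtapose C l (plug C (v' # vs') ls')))"
      using juxtapose_assoc[OF uv seam_juxtapose2[OF v(3,4)]] by (simp add: juxtapose_single)
    with u v Cons show ?thesis by (simp add: juxtapose_single)
  qed
next
  case (Cons k ks)
  then obtain u u' us' where u: "us = u # u' # us'" "fits (u' # us') ks" "seam [u] k"
    "seam k (plug C (u' # us') ks)" by (auto elim: fits_Cons)
  have s: "seam (u' # us') vs" using Cons.prems u by (auto simp: seam_def spliced_def)
  have s2: "seam (plug C (u' # us') ks) (plug C vs ls)"
    using s fits_plug[OF u(2)] fits_plug[OF Cons.prems(3)] by (auto simp: seam_def)
  have "plug C (juxtapose C us vs) ((k # ks) @ ls) =
    juxtapose C [u] (juxtapose C k (juxtapose C (plug C (u' # us') ks) (plug C vs ls)))"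
    using Cons.IH[OF s u(2) Cons.prems(3)] u(1) by (simp add: juxtapose_Cons)
  also have "\<dots> = juxtapose C [u] (juxtapose C (juxtapose C k (plug C (u' # us') ks)) (plug C vs ls))"
    by (simp add: juxtapose_assoc[OF u(4) s2])
  also have "\<dots> = juxtapose C (plug C us (k # ks)) (plug C vs ls)"
    using juxtapose_assoc[OF seam_juxtapose2[OF u(3,4)] seam_juxtapose1[OF u(4) s2]] u(1) by simp
  finally show ?case .
qed

lemma plug_assoc:
  assumes "fits ws hs" "list_all2 fits hs kss"
  shows "plug C (plug C ws hs) (concat kss) = plug C ws (map2 (plug C) hs kss)"
  using assms(2,1)
proof (induction arbitrary: ws rule: list_all2_induct)
  case Nil
  then show ?case by (auto simp: fits_Nil)
next
  case (Cons h hs ks kss)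
  then obtain w w' ws' where w: "ws = w # w' # ws'" "fits (w' # ws') hs" "seam [w] h"
    "seam h (plug C (w' # ws') hs)" by (auto elim: fits_Cons)
  let ?R = "plug C (w' # ws') hs"
  have lg: "fits ?R (concat kss)"
  proof -
    have "map (\<lambda>h. (Dom C (hd h), Cod C (last h))) (concat kss) = concat (map (gaps C) hs)"
      "\<forall>k\<in>set (concat kss). spliced k"
      using Cons.hyps(2) by (induction rule: list_all2_induct) (auto simp: fits_def)
    with fits_plug[OF w(2)] show ?thesis by (simp add: fits_def)
  qed
  have lw: "fits [w] []" using w(3) by (auto simp: fits_Nil seam_def spliced_def)
  have lhR: "fits (juxtapose C h ?R) (ks @ concat kss)"
    using Cons.hyps(1) lg juxtapose_typing[OF w(4)] by (auto simp: fits_def)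
  have "plug C (juxtapose C [w] (juxtapose C h ?R)) ([] @ ks @ concat kss) =
    juxtapose C [w] (juxtapose C (plug C h ks) (plug C ?R (concat kss)))"
    using plug_juxtapose[OF seam_juxtapose2[OF w(3,4)] lw lhR]
      plug_juxtapose[OF w(4) Cons.hyps(1) lg] by simp
  with Cons.IH[OF w(2)] w(1) show ?case by simp
qed

lemma plug_Id:
  assumes "spliced ws"
  shows "plug C ws (map (\<lambda>(A, B). [Id C A, Id C B]) (gaps C ws)) = ws"
  using assms
proof (induction ws)
  case Nil
  then show ?case by (simp add: spliced_def)
next
  case (Cons w ws)
  then show ?case
    by (cases ws) (auto simp: spliced_def juxtapose_def Comp_Id Id_Comp)
qed

lemma gaps_in: "spliced ws \<Longrightarrow> set (gaps C ws) \<subseteq> Obj C \<times> Obj C"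
proof (induction ws)
  case (Cons w ws)
  then show ?case by (cases ws) (auto simp: spliced_def Dom_in Cod_in)
qed simp

lemma Id_plug:
  assumes "spliced ws"
  shows "plug C [Id C (Dom C (hd ws)), Id C (Cod C (last ws))] [ws] = ws"
proof -
  have *: "juxtapose C ws [Id C (Cod C (last ws))] = ws"
    using assms Comp_Id[of "last ws"] last_in_set[of ws]
    by (auto simp: juxtapose_def spliced_def subset_eq)
  have "juxtapose C [Id C (Dom C (hd ws))] ws = ws"
    using assms Id_Comp[of "hd ws"] hd_in_set[of ws]
    by (auto simp: juxtapose_def spliced_def subset_eq)
  with * show ?thesis by simp
qed

lemma operad_spliced_arrows: "operad \<W>[C]"
proof
  fix g hs kss
  assume 1: "fits g hs" and 2: "list_all2 fits hs kss"
  then show "OpComp \<W>[C] (OpComp \<W>[C] g hs) (concat kss) =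
      OpComp \<W>[C] g (map2 (OpComp \<W>[C]) hs kss)"
    using plug_assoc[OF 1 2] by (simp add: spliced_arrows_def)
next
  fix f assume "f \<in> Ops \<W>[C]"
  then have f: "spliced f" by (simp add: spliced_arrows_def spliced_def)
  show "set (Inputs \<W>[C] f) \<subseteq> Colors \<W>[C]"
    using gaps_in[OF f] by (simp add: spliced_arrows_def)
  show "Output \<W>[C] f \<in> Colors \<W>[C]"
    using f hd_in_set[of f] last_in_set[of f]
    by (auto simp: spliced_arrows_def spliced_def subset_eq Dom_in Cod_in)
  show "OpComp \<W>[C] (OpId \<W>[C] (Output \<W>[C] f)) [f] = f"
    using Id_plug[OF f] by (simp add: spliced_arrows_def)
  show "OpComp \<W>[C] f (map (OpId \<W>[C]) (Inputs \<W>[C] f)) = f"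
    using plug_Id[OF f] by (simp add: spliced_arrows_def)
next
  fix g hs assume "fits g hs"
  note fits_plug[OF this]
  then show "OpComp \<W>[C] g hs \<in> Ops \<W>[C]"
    "Inputs \<W>[C] (OpComp \<W>[C] g hs) = concat (map (Inputs \<W>[C]) hs)"
    "Output \<W>[C] (OpComp \<W>[C] g hs) = Output \<W>[C] g"
    by (auto simp: spliced_arrows_def spliced_def)
qed (auto simp: spliced_arrows_def Id_in Dom_Id Cod_Id gaps_def)

end

context category_functor
begin

lemma map_juxtapose:
  assumes "Q.seam us vs"
  shows "map (on_Arr p) (juxtapose Q us vs) = juxtapose C (map (on_Arr p) us) (map (on_Arr p) vs)"
proof -
  have "us \<noteq> []" "vs \<noteq> []" "last us \<in> Arr Q" "hd vs \<in> Arr Q" "Cod Q (last us) = Dom Q (hd vs)"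
    using assms by (auto simp: Q.seam_def Q.spliced_def)
  then show ?thesis by (simp add: juxtapose_def map_butlast map_tl last_map hd_map on_Arr_Comp)
qed

lemma map_plug:
  assumes "composable \<W>[Q] ws hs"
  shows "map (on_Arr p) (plug Q ws hs) = plug C (map (on_Arr p) ws) (map (map (on_Arr p)) hs)"
  using assms
proof (induction hs arbitrary: ws)
  case Nil
  then show ?case by simp
next
  case (Cons h hs)
  then obtain w w' ws' where w: "ws = w # w' # ws'" "composable \<W>[Q] (w' # ws') hs" "Q.seam [w] h"
    "Q.seam h (plug Q (w' # ws') hs)" by (auto elim: Q.fits_Cons)
  show ?case
    using Cons.IH[OF w(2)] map_juxtapose[OF w(4)] map_juxtapose[OF Q.seam_juxtapose2[OF w(3,4)]] w(1)
    by simp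
qed

lemma gaps_map:
  "set ws \<subseteq> Arr Q \<Longrightarrow>
    gaps C (map (on_Arr p) ws) = map (map_prod (on_Obj p) (on_Obj p)) (gaps Q ws)"
proof (induction ws)
  case (Cons w ws)
  then show ?case by (cases ws) (auto simp: Dom_on_Arr Cod_on_Arr)
qed simp

lemma operad_functor_spliced_functor: "operad_functor \<W>[Q] \<W>[C] \<W>\<^sub>F[p]"
proof (intro operad_functor.intro operad_functor_axioms.intro
    Q.operad_spliced_arrows C.operad_spliced_arrows)
  fix g hs assume "composable \<W>[Q] g hs"
  from map_plug[OF this] show "on_Op \<W>\<^sub>F[p] (OpComp \<W>[Q] g hs) =
      OpComp \<W>[C] (on_Op \<W>\<^sub>F[p] g) (map (on_Op \<W>\<^sub>F[p]) hs)"
    by (simp add: spliced_arrows_def spliced_functor_def)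
qed (auto simp: spliced_arrows_def spliced_functor_def on_Obj_in on_Arr_in gaps_map
      Dom_on_Arr Cod_on_Arr on_Arr_Id hd_map last_map subset_eq)

end

end

theory Submission
  imports Defs
begin

text \<open>A factorization of a juxtaposition \<open>u\<^sub>0-\<dots>-u\<^sub>m v\<^sub>0-\<dots>-v\<^sub>n\<close> in \<open>\<W>[C]\<close> only factors the
  arrow \<open>u\<^sub>m v\<^sub>0\<close> at the seam, so ULF functors lift it uniquely.  A composite in \<open>\<W>[C]\<close> is an
  iterated juxtaposition \<open>w\<^sub>0 h\<^sub>1 w\<^sub>1 \<dots> h\<^sub>n w\<^sub>n\<close>, which is lifted one seam at a time; the seams
  that arise say exactly that the lifted operations have matching colors.\<close>

context category
begin

text \<open>Converse of the elimination rule \<open>fits_Cons\<close>. It lets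
  \<open>lift_plug\<close> reassemble a well-typed composite from pieces whose seams were obtained
  one by one.\<close>

lemma fits_ConsI:
  assumes "fits (w' # ws) hs" "seam [w] h" "seam h (plug C (w' # ws) hs)"
  shows "fits (w # w' # ws) (h # hs)"
  using assms fits_plug[OF assms(1)] by (auto simp: fits_def seam_def spliced_def)

end

context ulf_category_functor
begin

text \<open>Existence at one seam. Mapping preserves positions, so exactly one arrow of \<alpha>
  lies over the composite at the seam; it alone has to be factored, and the arrows on either side
  are kept as they are.\<close>

lemma lift_juxtapose:
  assumes "Q.spliced \<alpha>" "C.seam us vs" "map (on_Arr p) \<alpha> = juxtapose C us vs"
  obtains us' vs' where "Q.seam us' vs'" "\<alpha> = juxtapose Q us' vs'"
    "map (on_Arr p) us' = us" "map (on_Arr p) vs' = vs"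
proof -
  have seam: "us \<noteq> []" "vs \<noteq> []" "last us \<in> Arr C" "hd vs \<in> Arr C"
    "Cod C (last us) = Dom C (hd vs)"
    using assms(2) by (auto simp: C.seam_def C.spliced_def)
  \<comment> \<open>By definition \<open>juxtapose C us vs\<close> is \<open>butlast us\<close>,
    then the composite at the seam, then \<open>tl vs\<close>; a list mapped onto it splits in the
    same places.\<close>
  from assms(3) obtain xs a ys where \<alpha>: "\<alpha> = xs @ a # ys" "map (on_Arr p) xs = butlast us"
    "on_Arr p a = last us \<cdot>\<^bsub>C\<^esub> hd vs" "map (on_Arr p) ys = tl vs"
    by (auto simp: juxtapose_def map_eq_append_conv map_eq_Cons_conv)
  have "a \<in> Arr Q" using assms(1) \<alpha>(1) by (auto simp: Q.spliced_def)
  from unique_lift[OF this seam(3-5) \<alpha>(3)] obtain b c where bc: "b \<in> Arr Q" "c \<in> Arr Q"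
    "Cod Q b = Dom Q c" "a = b \<cdot>\<^bsub>Q\<^esub> c" "on_Arr p b = last us" "on_Arr p c = hd vs"
    by (auto simp: Ex1_def)
  show ?thesis
  proof (rule that)
    show "Q.seam (xs @ [b]) (c # ys)"
      using assms(1) \<alpha>(1) bc by (auto simp: Q.seam_def Q.spliced_def)
    show "\<alpha> = juxtapose Q (xs @ [b]) (c # ys)" using \<alpha>(1) bc(4) by (simp add: juxtapose_def)
    show "map (on_Arr p) (xs @ [b]) = us" "map (on_Arr p) (c # ys) = vs"
      using \<alpha> bc seam by simp_all
  qed
qed

text \<open>Uniqueness at one seam. Equal images force equal lengths, so both juxtapositions have
  their seam at the same position; there, two factorizations of one arrow lie over the same
  factorization in \<open>C\<close>.\<close>

lemma juxtapose_cancel: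
  assumes "Q.seam us vs" "Q.seam us' vs'" "juxtapose Q us vs = juxtapose Q us' vs'"
    "map (on_Arr p) us = map (on_Arr p) us'" "map (on_Arr p) vs = map (on_Arr p) vs'"
  shows "us = us' \<and> vs = vs'"
proof -
  have nonempty: "us \<noteq> []" "us' \<noteq> []" "vs \<noteq> []" "vs' \<noteq> []"
    using assms(1,2) by (auto simp: Q.seam_def Q.spliced_def)
  have len: "length (butlast us) = length (butlast us')"
    using map_eq_imp_length_eq[OF assms(4)] by simp
  have b: "butlast us = butlast us'" and t: "tl vs = tl vs'"
    and a: "last us \<cdot>\<^bsub>Q\<^esub> hd vs = last us' \<cdot>\<^bsub>Q\<^esub> hd vs'"
    using assms(3) len by (simp_all add: juxtapose_def)
  have p: "on_Arr p (last us) = on_Arr p (last us')" "on_Arr p (hd vs) = on_Arr p (hd vs')"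
    using assms(4,5) nonempty by (metis last_map, metis hd_map)
  have s: "last us \<in> Arr Q" "hd vs \<in> Arr Q" "Cod Q (last us) = Dom Q (hd vs)"
    "last us' \<in> Arr Q" "hd vs' \<in> Arr Q" "Cod Q (last us') = Dom Q (hd vs')"
    using assms(1,2) by (auto simp: Q.seam_def Q.spliced_def)
  have "\<exists>!(\<beta>, \<gamma>). \<beta> \<in> Arr Q \<and> \<gamma> \<in> Arr Q \<and> Cod Q \<beta> = Dom Q \<gamma> \<and>
      last us \<cdot>\<^bsub>Q\<^esub> hd vs = \<beta> \<cdot>\<^bsub>Q\<^esub> \<gamma> \<and> on_Arr p \<beta> = on_Arr p (last us) \<and>
      on_Arr p \<gamma> = on_Arr p (hd vs)"
    using s by (intro unique_lift)
      (simp_all add: Q.Comp_in on_Arr_in Dom_on_Arr Cod_on_Arr on_Arr_Comp)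
  \<comment> \<open>Both pairs satisfy the predicate of the unique lift, so each equals its definite
    description.\<close>
  from the1_equality[OF this, of "(last us, hd vs)"] the1_equality[OF this, of "(last us', hd vs')"]
  have "(last us, hd vs) = (last us', hd vs')"
    using s a p by simp
  with b t nonempty show ?thesis
    by (metis append_butlast_last_id list.collapse prod.inject)
qed

text \<open>Each step of the induction lifts two seams, first the one after \<open>w\<close> and
  then the one after \<open>h\<close>. The remainder \<open>\<alpha>''\<close> lies over the
  composite of the shorter lists, which is why \<alpha> and \<open>g\<close> are
  generalized.\<close>

lemma lift_plug:
  assumes "Q.spliced \<alpha>" "C.fits g hs" "map (on_Arr p) \<alpha> = plug C g hs"
  shows "\<exists>\<beta> \<gamma>s. Q.fits \<beta> \<gamma>s \<and> \<alpha> = plug Q \<beta> \<gamma>s \<and>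
    map (on_Arr p) \<beta> = g \<and> map (map (on_Arr p)) \<gamma>s = hs"
  using assms
proof (induction hs arbitrary: \<alpha> g)
  case Nil
  then obtain a where "\<alpha> = [a]" "a \<in> Arr Q" "g = [on_Arr p a]"
    by (auto simp: C.fits_Nil Q.spliced_def)
  then show ?case by (intro exI[of _ "[a]"] exI[of _ "[]"]) (simp add: Q.fits_Nil)
next
  case (Cons h hs)
  from Cons.prems(2) obtain w w' ws where g: "g = w # w' # ws" "C.fits (w' # ws) hs"
    "C.seam [w] h" "C.seam h (plug C (w' # ws) hs)"
    by (auto elim: C.fits_Cons)
  from Cons.prems(3) g(1) have
    "map (on_Arr p) \<alpha> = juxtapose C [w] (juxtapose C h (plug C (w' # ws) hs))"
    by simp
  then obtain us \<alpha>' where 1: "Q.seam us \<alpha>'" "\<alpha> = juxtapose Q us \<alpha>'" "map (on_Arr p) us = [w]"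
    "map (on_Arr p) \<alpha>' = juxtapose C h (plug C (w' # ws) hs)"
    by (rule lift_juxtapose[OF Cons.prems(1) C.seam_juxtapose2[OF g(3,4)]])
  obtain b where us: "us = [b]" "on_Arr p b = w" using 1(3) by auto
  have "Q.spliced \<alpha>'" using 1(1) by (simp add: Q.seam_def)
  from lift_juxtapose[OF this g(4) 1(4)]
  obtain \<gamma> \<alpha>'' where 2: "Q.seam \<gamma> \<alpha>''" "\<alpha>' = juxtapose Q \<gamma> \<alpha>''"
    "map (on_Arr p) \<gamma> = h" "map (on_Arr p) \<alpha>'' = plug C (w' # ws) hs" .
  have "Q.spliced \<alpha>''" using 2(1) by (simp add: Q.seam_def)
  from Cons.IH[OF this g(2) 2(4)] obtain \<beta> \<gamma>s where 3: "Q.fits \<beta> \<gamma>s" "\<alpha>'' = plug Q \<beta> \<gamma>s"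
    "map (on_Arr p) \<beta> = w' # ws" "map (map (on_Arr p)) \<gamma>s = hs"
    by (elim exE conjE)
  obtain b' bs where \<beta>: "\<beta> = b' # bs" using 3(3) by auto
  \<comment> \<open>The first lift gives a seam between \<open>[b]\<close> and all of
    \<open>\<alpha>'\<close>; juxtaposition keeps the domain of its leading arrow, so the same seam
    holds with \<gamma>.\<close>
  have "Q.seam [b] \<gamma>"
    using 1(1) 2(1,2) us Q.juxtapose_typing[OF 2(1)] by (auto simp: Q.seam_def)
  then have "Q.fits (b # \<beta>) (\<gamma> # \<gamma>s)"
    using Q.fits_ConsI 2(1) 3(1,2) \<beta> by blast
  moreover have "\<alpha> = plug Q (b # \<beta>) (\<gamma> # \<gamma>s)"
    using 1(2) 2(2) 3(2) us by simp
  ultimately show ?case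
    using 2(3) 3(3,4) us(2) g(1) by (intro exI[of _ "b # \<beta>"] exI[of _ "\<gamma> # \<gamma>s"]) simp
qed

text \<open>The seams are peeled off in the same order as in \<open>lift_plug\<close>, with
  \<open>juxtapose_cancel\<close> applied twice per gap.\<close>

lemma plug_cancel:
  assumes "Q.fits \<beta> \<gamma>s" "Q.fits \<beta>' \<gamma>s'" "plug Q \<beta> \<gamma>s = plug Q \<beta>' \<gamma>s'"
    "map (on_Arr p) \<beta> = map (on_Arr p) \<beta>'"
    "map (map (on_Arr p)) \<gamma>s = map (map (on_Arr p)) \<gamma>s'"
  shows "\<beta> = \<beta>' \<and> \<gamma>s = \<gamma>s'"
  using assms
proof (induction \<gamma>s arbitrary: \<beta> \<beta>' \<gamma>s')
  case Nil
  then show ?case by (auto simp: Q.fits_Nil)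
next
  case (Cons \<gamma> \<gamma>s)
  from Cons.prems(5) obtain \<delta> \<delta>s where \<gamma>s': "\<gamma>s' = \<delta> # \<delta>s"
    "map (on_Arr p) \<gamma> = map (on_Arr p) \<delta>" "map (map (on_Arr p)) \<gamma>s = map (map (on_Arr p)) \<delta>s"
    by (cases \<gamma>s') auto
  from Cons.prems(1) obtain b b' bs where \<beta>: "\<beta> = b # b' # bs" "Q.fits (b' # bs) \<gamma>s"
    "Q.seam [b] \<gamma>" "Q.seam \<gamma> (plug Q (b' # bs) \<gamma>s)" by (auto elim: Q.fits_Cons)
  from Cons.prems(2) \<gamma>s'(1) obtain c c' cs where \<beta>': "\<beta>' = c # c' # cs" "Q.fits (c' # cs) \<delta>s"
    "Q.seam [c] \<delta>" "Q.seam \<delta> (plug Q (c' # cs) \<delta>s)" by (auto elim: Q.fits_Cons)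
  have p: "on_Arr p b = on_Arr p c" "map (on_Arr p) (b' # bs) = map (on_Arr p) (c' # cs)"
    using Cons.prems(4) \<beta>(1) \<beta>'(1) by simp_all
  \<comment> \<open>Cancelling at a seam requires that the right-hand parts have equal images;
    functoriality of \<open>plug\<close> reduces this to the equal images of the pieces.\<close>
  have p': "map (on_Arr p) (plug Q (b' # bs) \<gamma>s) = map (on_Arr p) (plug Q (c' # cs) \<delta>s)"
    using map_plug[OF \<beta>(2)] map_plug[OF \<beta>'(2)] p(2) \<gamma>s'(3) by simp
  have 1: "[b] = [c] \<and> juxtapose Q \<gamma> (plug Q (b' # bs) \<gamma>s) = juxtapose Q \<delta> (plug Q (c' # cs) \<delta>s)"
  proof (rule juxtapose_cancel)
    show "juxtapose Q [b] (juxtapose Q \<gamma> (plug Q (b' # bs) \<gamma>s)) =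
        juxtapose Q [c] (juxtapose Q \<delta> (plug Q (c' # cs) \<delta>s))"
      using Cons.prems(3) \<beta>(1) \<beta>'(1) \<gamma>s'(1) by simp
    show "map (on_Arr p) (juxtapose Q \<gamma> (plug Q (b' # bs) \<gamma>s)) =
        map (on_Arr p) (juxtapose Q \<delta> (plug Q (c' # cs) \<delta>s))"
      using map_juxtapose[OF \<beta>(4)] map_juxtapose[OF \<beta>'(4)] p' \<gamma>s'(2) by simp
  qed (simp_all add: p(1) Q.seam_juxtapose2 \<beta>(3,4) \<beta>'(3,4))
  then have 2: "\<gamma> = \<delta> \<and> plug Q (b' # bs) \<gamma>s = plug Q (c' # cs) \<delta>s"
    using juxtapose_cancel[OF \<beta>(4) \<beta>'(4)] \<gamma>s'(2) p' by blast
  then have "b' # bs = c' # cs \<and> \<gamma>s = \<delta>s"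
    using Cons.IH[OF \<beta>(2) \<beta>'(2)] p(2) \<gamma>s'(3) by blast
  with 1 2 show ?case using \<beta>(1) \<beta>'(1) \<gamma>s'(1) by simp
qed

lemma ulf_spliced_functor: "ulf_operad_functor \<W>[Q] \<W>[C] \<W>\<^sub>F[p]"
proof (intro ulf_operad_functor.intro ulf_operad_functor_axioms.intro
    operad_functor_spliced_functor)
  fix \<alpha> g hs
  assume "\<alpha> \<in> Ops \<W>[Q]" "C.fits g hs" "on_Op \<W>\<^sub>F[p] \<alpha> = OpComp \<W>[C] g hs"
  then have "Q.spliced \<alpha>" "C.fits g hs" "map (on_Arr p) \<alpha> = plug C g hs"
    by (simp_all add: spliced_arrows_def spliced_functor_def Q.spliced_def)
  from lift_plug[OF this] obtain \<beta> \<gamma>s where lift: "Q.fits \<beta> \<gamma>s" "\<alpha> = plug Q \<beta> \<gamma>s"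
    "map (on_Arr p) \<beta> = g" "map (map (on_Arr p)) \<gamma>s = hs"
    by blast
  show "\<exists>!(\<beta>, \<gamma>s). Q.fits \<beta> \<gamma>s \<and> \<alpha> = OpComp \<W>[Q] \<beta> \<gamma>s \<and>
      on_Op \<W>\<^sub>F[p] \<beta> = g \<and> map (on_Op \<W>\<^sub>F[p]) \<gamma>s = hs"
  proof (rule ex1I[of _ "(\<beta>, \<gamma>s)"])
    show "case (\<beta>, \<gamma>s) of (\<beta>, \<gamma>s) \<Rightarrow> Q.fits \<beta> \<gamma>s \<and> \<alpha> = OpComp \<W>[Q] \<beta> \<gamma>s \<and>
        on_Op \<W>\<^sub>F[p] \<beta> = g \<and> map (on_Op \<W>\<^sub>F[p]) \<gamma>s = hs"
      using lift by (simp add: spliced_arrows_def spliced_functor_def)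
  next
    fix x
    assume "case x of (\<beta>, \<gamma>s) \<Rightarrow> Q.fits \<beta> \<gamma>s \<and> \<alpha> = OpComp \<W>[Q] \<beta> \<gamma>s \<and>
        on_Op \<W>\<^sub>F[p] \<beta> = g \<and> map (on_Op \<W>\<^sub>F[p]) \<gamma>s = hs"
    then obtain \<beta>' \<gamma>s' where x: "x = (\<beta>', \<gamma>s')" "Q.fits \<beta>' \<gamma>s'" "\<alpha> = plug Q \<beta>' \<gamma>s'"
      "map (on_Arr p) \<beta>' = g" "map (map (on_Arr p)) \<gamma>s' = hs"
      by (cases x) (simp add: spliced_arrows_def spliced_functor_def)
    \<comment> \<open>Both decompositions compose to \<alpha> and lie over the same \<open>g\<close>
      and \<open>hs\<close>.\<close>
    have "\<beta>' = \<beta> \<and> \<gamma>s' = \<gamma>s"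
      by (rule plug_cancel) (use x lift in simp_all)
    with x(1) show "x = (\<beta>, \<gamma>s)" by simp
  qed
qed

end

text \<open>A list over \<open>w # ws\<close> is a head over \<open>w\<close> followed by a tail
  over \<open>ws\<close>, so the fiber is covered by the image of a product of two finite
  sets.\<close>

lemma finite_map_fiber:
  assumes "\<And>w. w \<in> set ws \<Longrightarrow> finite {x \<in> A. f x = w}"
  shows "finite {xs. set xs \<subseteq> A \<and> map f xs = ws}"
  using assms
proof (induction ws)
  case Nil
  then show ?case by simp
next
  case (Cons w ws)
  have "{xs. set xs \<subseteq> A \<and> map f xs = w # ws} \<subseteq>
      case_prod (#) ` ({x \<in> A. f x = w} \<times> {xs. set xs \<subseteq> A \<and> map f xs = ws})"
    by (auto simp: map_eq_Cons_conv image_iff)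
  moreover have "finite \<dots>" using Cons by simp
  ultimately show ?case by (rule finite_subset)
qed

context finitary_category_functor
begin

lemma finitary_spliced_functor: "finitary_operad_functor \<W>[Q] \<W>[C] \<W>\<^sub>F[p]"
proof (intro finitary_operad_functor.intro finitary_operad_functor_axioms.intro
    operad_functor_spliced_functor)
  fix c assume "c \<in> Colors \<W>[C]"
  then obtain A B where c: "c = (A, B)" "A \<in> Obj C" "B \<in> Obj C"
    by (auto simp: spliced_arrows_def)
  \<comment> \<open>\<open>\<W>\<^sub>F[p]\<close> acts componentwise on colors, so the fiber over a
    pair is the product of the two object fibers.\<close>
  have "{X \<in> Colors \<W>[Q]. on_Color \<W>\<^sub>F[p] X = c} =
      {X \<in> Obj Q. on_Obj p X = A} \<times> {X \<in> Obj Q. on_Obj p X = B}"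
    using c(1) by (auto simp: spliced_arrows_def spliced_functor_def)
  then show "finite {X \<in> Colors \<W>[Q]. on_Color \<W>\<^sub>F[p] X = c}"
    using c by (simp add: finite_Obj_fiber)
next
  fix ws assume "ws \<in> Ops \<W>[C]"
  then have "finite {f \<in> Arr Q. on_Arr p f = w}" if "w \<in> set ws" for w
    using that by (intro finite_Arr_fiber) (auto simp: spliced_arrows_def)
  then have "finite {\<alpha>. set \<alpha> \<subseteq> Arr Q \<and> map (on_Arr p) \<alpha> = ws}"
    by (rule finite_map_fiber)
  then show "finite {\<alpha> \<in> Ops \<W>[Q]. on_Op \<W>\<^sub>F[p] \<alpha> = ws}"
    \<comment> \<open>The operations over \<open>ws\<close> are among the lists of arrows over
      \<open>ws\<close>, whose finiteness was just shown.\<close>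
    by (rule rev_finite_subset) (auto simp: spliced_arrows_def spliced_functor_def)
qed

end

theorem proposition3p9:
  fixes Q :: "('o, 'a) category_data" and C :: "('p, 'b) category_data"
    and p :: "('o, 'a, 'p, 'b) functor_data"
  assumes "category_functor Q C p"
  shows "(ulf_category_functor Q C p \<longrightarrow> ulf_operad_functor \<W>[Q] \<W>[C] \<W>\<^sub>F[p]) \<and>
         (finitary_category_functor Q C p \<longrightarrow> finitary_operad_functor \<W>[Q] \<W>[C] \<W>\<^sub>F[p])"
  using ulf_category_functor.ulf_spliced_functor
    finitary_category_functor.finitary_spliced_functor by blast

end
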